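(* Let $\mathcal M$ be a weighted $\widetilde{gl}(\infty)$-module generated by a subspace $\mathcal M_0$ such that $\widetilde{gl}^m(\infty)(\mathcal M_0)=\{0\}$ for some $m\in\mathbb N$, and let $\iota\in\mathbb C$ with $\iota\notin\mathbb Z/2$. Then the representation $\sigma^\iota_{\mathcal M}$ of $\hat o(\vec\ell,\mathbb A)$ on $\mathcal M$ is irreducible if and only if $\mathcal M$ is an irreducible $\widetilde{gl}(\infty)$-module.
   Context: All spaces are over $\mathbb C$; $\mathbb N$ = nonnegative integers; $\overline{1,n}=\{1,\dots,n\}$; $\mathcal Z=\mathbb Z+1/2$; $\mathbb Z/2=\{k/2:k\in\mathbb Z\}$; $\langle\mu\rangle_0=1$, $\langle\mu\rangle_m=\mu(\mu-1)\cdots(\mu-m+1)$. $\partial_t=d/dt$, $\mathbb A=\sum_{i\ge0}\mathbb C[t,t^{-1}]\partial_t^i$, $E_{i,j}$ the $n\times n$ matrix units. $\widehat{gl}(n,\mathbb A)=M_{n\times n}(\mathbb A)\oplus\mathbb C\kappa$ has $\kappa$ central and $$[t^{m_1}\partial_t^{r_1}E_{i_1,j_1},t^{m_2}\partial_t^{r_2}E_{i_2,j_2}]=\delta_{j_1,i_2}t^{m_1}\partial_t^{r_1}\cdot t^{m_2}\partial_t^{r_2}E_{i_1,j_2}-\delta_{i_1,j_2}t^{m_2}\partial_t^{r_2}\cdot t^{m_1}\partial_t^{r_1}E_{i_2,j_1}+(-1)^{r_1}\delta_{i_1,j_2}\delta_{j_1,i_2}\delta_{r_1+r_2,m_1+m_2}r_1!r_2!\binom{m_1}{r_1+r_2+1}\kappa.$$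 Put $i^*=n+1-i$; fix $\epsilon\in\{0,1\}$ and $\vec\ell\in\mathbb N^n$ with $\ell_i\in2\mathbb N+\epsilon$ and $\ell_i=\ell_{i^*}$ for all $i$. $\hat o(\vec\ell,\mathbb A)$ is the Lie subalgebra of $\widehat{gl}(n,\mathbb A)$ spanned by $\kappa$ and all $t^m\partial_t^{r+\ell_j}E_{i,j}-(-1)^\epsilon(-\partial_t)^rt^m\partial_t^{\ell_i}E_{j^*,i^*}$ ($i,j\in\overline{1,n}$, $r\in\mathbb N$, $m\in\mathbb Z$). $\overline{gl}(\infty)$ has basis $\{\mathcal E_{l,k}\mid l,k\in\mathcal Z\}$ with $\mathcal E_{l_1,l_2}\mathcal E_{k_1,k_2}=\delta_{l_2+k_1,0}\mathcal E_{l_1,k_2}$; $\widetilde{gl}(\infty)=\overline{gl}(\infty)\oplus\mathbb C\kappa_0$ with $\kappa_0$ central and $$[\mathcal E_{l_1,l_2},\mathcal E_{k_1,k_2}]=\mathcal E_{l_1,l_2}\mathcal E_{k_1,k_2}-\mathcal E_{k_1,k_2}\mathcal E_{l_1,l_2}+\delta_{l_1+k_2,0}\delta_{l_2+k_1,0}[H(l_1)H(l_2)-H(k_1)H(k_2)]\kappa_0,$$ $H(l)=1$ for $l>0$, $0$ for $l<0$. $\mathcal T=\sum_{l\in\mathcal Z}\mathbb C\mathcal E_{l,-l}+\mathbb C\kappa_0$; a module is weighted if it is the direct sum of its $\mathcal T$-weight spaces. $\widetilde{gl}^m(\infty)=\mathrm{Span}\{\mathcal E_{l_1,-l_2},\mathcal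 E_{-l_1,l_2}\mid l_1,l_2\in\mathcal Z,\ l_1,l_2>m\}$. $\sigma^\iota_{\mathcal M}$ is the restriction to $\hat o(\vec\ell,\mathbb A)$ of the representation of $\widehat{gl}(n,\mathbb A)$ on $\mathcal M$ given by $\kappa\mapsto\kappa_0$ and $$t^m\partial_t^rE_{i,j}\mapsto\sum_{l\in\mathbb Z}\langle\iota-l\rangle_r\,\mathcal E_{(m-r-l)n+i-1/2,\,ln-j+1/2}+r!\,\delta_{i,j}\delta_{r,m}\Im_{0,r}\,\kappa_0\qquad(m\in\mathbb Z,\ r\in\mathbb N),$$ where $\sum_{r_1,r_2\ge0}\Im_{r_1,r_2}x^{r_1}y^{r_2}z^{-r_1-r_2-1}=\frac1{x-y}\bigl((\frac{z+y}{z+x})^\iota-1\bigr)$, expanded in nonnegative powers of $x,y$. *)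

theory Defs
  imports
    Complex_Main
    "HOL-Library.Poly_Mapping"
    "HOL-Computational_Algebra.Formal_Power_Series"
begin

section \<open>Complex vector spaces with a given basis\<close>

text \<open>
  The complex vector space with basis \<open>'b\<close> is the type \<open>'b \<Rightarrow>\<^sub>0 complex\<close> of finitely supported
  functions; \<open>single b 1\<close> is the basis vector \<open>b\<close>.  The convolution product which the library
  puts on this type is never used.
\<close>

definition pscale :: "complex \<Rightarrow> ('b \<Rightarrow>\<^sub>0 complex) \<Rightarrow> ('b \<Rightarrow>\<^sub>0 complex)" where
  "pscale c x = Poly_Mapping.map ((*) c) x"

abbreviation bvec :: "'b \<Rightarrow> ('b \<Rightarrow>\<^sub>0 complex)" where
  "bvec b \<equiv> Poly_Mapping.single b 1"

definition lin_ext ::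
    "(complex \<Rightarrow> 'v \<Rightarrow> 'v) \<Rightarrow> ('b \<Rightarrow> 'v::ab_group_add) \<Rightarrow> ('b \<Rightarrow>\<^sub>0 complex) \<Rightarrow> 'v" where
  "lin_ext scale f x = (\<Sum>b\<in>Poly_Mapping.keys x. scale (Poly_Mapping.lookup x b) (f b))"

definition bilin_ext ::
    "('a \<Rightarrow> 'b \<Rightarrow> ('c \<Rightarrow>\<^sub>0 complex)) \<Rightarrow> ('a \<Rightarrow>\<^sub>0 complex) \<Rightarrow> ('b \<Rightarrow>\<^sub>0 complex) \<Rightarrow> ('c \<Rightarrow>\<^sub>0 complex)" where
  "bilin_ext f x y = lin_ext pscale (\<lambda>a. lin_ext pscale (f a) y) x"

lemma lookup_pscale [simp]: "Poly_Mapping.lookup (pscale c x) b = c * Poly_Mapping.lookup x b"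
  by (simp add: pscale_def Poly_Mapping.map.rep_eq when_def)

lemma vector_space_pscale: "vector_space (pscale :: complex \<Rightarrow> ('b \<Rightarrow>\<^sub>0 complex) \<Rightarrow> _)"
  by unfold_locales (auto intro!: poly_mapping_eqI simp: lookup_add algebra_simps)

lemma pscale_single [simp]: "pscale c (Poly_Mapping.single b d) = Poly_Mapping.single b (c * d)"
  by (auto intro!: poly_mapping_eqI simp: lookup_single when_def)

lemma lin_ext_superset:
  assumes "vector_space scale" "finite S" "Poly_Mapping.keys x \<subseteq> S"
  shows "lin_ext scale f x = (\<Sum>b\<in>S. scale (Poly_Mapping.lookup x b) (f b))"
proof -
  interpret vector_space scale by fact
  show ?thesis unfolding lin_ext_def
    by (rule sum.mono_neutral_left) (use assms in \<open>auto simp: in_keys_iff\<close>)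
qed

lemma linear_lin_ext:
  fixes f :: "'b \<Rightarrow> 'v::ab_group_add"
  assumes "vector_space scale"
  shows "Vector_Spaces.linear pscale scale (lin_ext scale f)"
proof -
  interpret V: vector_space scale by fact
  interpret P: vector_space "pscale :: complex \<Rightarrow> ('b \<Rightarrow>\<^sub>0 complex) \<Rightarrow> _"
    by (rule vector_space_pscale)
  show ?thesis
  proof (unfold_locales)
    fix x y :: "'b \<Rightarrow>\<^sub>0 complex"
    let ?S = "Poly_Mapping.keys x \<union> Poly_Mapping.keys y"
    have "lin_ext scale f z = (\<Sum>b\<in>?S. scale (Poly_Mapping.lookup z b) (f b))"
      if "Poly_Mapping.keys z \<subseteq> ?S" for z
      using that by (intro lin_ext_superset assms) auto
    from this[of x] this[of y] this[of "x + y"]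
    show "lin_ext scale f (x + y) = lin_ext scale f x + lin_ext scale f y"
      by (simp add: lookup_add V.scale_left_distrib sum.distrib Poly_Mapping.keys_add)
  next
    fix c and x :: "'b \<Rightarrow>\<^sub>0 complex"
    have "Poly_Mapping.keys (pscale c x) \<subseteq> Poly_Mapping.keys x"
      by (auto simp: in_keys_iff)
    then have "lin_ext scale f (pscale c x)
        = (\<Sum>b\<in>Poly_Mapping.keys x. scale (Poly_Mapping.lookup (pscale c x) b) (f b))"
      by (intro lin_ext_superset assms) auto
    then show "lin_ext scale f (pscale c x) = scale c (lin_ext scale f x)"
      by (simp add: lin_ext_def V.scale_sum_right)
  qed
qed

lemma lin_ext_single [simp]:
  assumes "vector_space scale"
  shows "lin_ext scale f (Poly_Mapping.single b c) = scale c (f b)"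
proof -
  interpret vector_space scale by fact
  show ?thesis by (subst lin_ext_superset[OF assms, of "{b}"]) auto
qed


section \<open>Lie algebra representations\<close>

text \<open>
  A Lie algebra is a subspace \<open>L\<close> of some \<open>'b \<Rightarrow>\<^sub>0 complex\<close> together with a bracket \<open>br\<close>; it acts
  on the complex vector space \<open>('v, scale)\<close>.
\<close>

definition lie_rep ::
    "(complex \<Rightarrow> 'v \<Rightarrow> 'v) \<Rightarrow> ('b \<Rightarrow>\<^sub>0 complex) set
      \<Rightarrow> (('b \<Rightarrow>\<^sub>0 complex) \<Rightarrow> ('b \<Rightarrow>\<^sub>0 complex) \<Rightarrow> ('b \<Rightarrow>\<^sub>0 complex))
      \<Rightarrow> (('b \<Rightarrow>\<^sub>0 complex) \<Rightarrow> 'v::ab_group_add \<Rightarrow> 'v) \<Rightarrow> bool" where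
  "lie_rep scale L br \<rho> \<longleftrightarrow>
     vector_space scale \<and>
     (\<forall>x\<in>L. Vector_Spaces.linear scale scale (\<rho> x)) \<and>
     (\<forall>x\<in>L. \<forall>y\<in>L. \<forall>v. \<rho> (x + y) v = \<rho> x v + \<rho> y v) \<and>
     (\<forall>c. \<forall>x\<in>L. \<forall>v. \<rho> (pscale c x) v = scale c (\<rho> x v)) \<and>
     (\<forall>x\<in>L. \<forall>y\<in>L. \<forall>v. \<rho> (br x y) v = \<rho> x (\<rho> y v) - \<rho> y (\<rho> x v))"

definition submodule ::
    "(complex \<Rightarrow> 'v \<Rightarrow> 'v) \<Rightarrow> 'g set \<Rightarrow> ('g \<Rightarrow> 'v::ab_group_add \<Rightarrow> 'v) \<Rightarrow> 'v set \<Rightarrow> bool" where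
  "submodule scale L \<rho> W \<longleftrightarrow> module.subspace scale W \<and> (\<forall>x\<in>L. \<forall>w\<in>W. \<rho> x w \<in> W)"

definition generated_by ::
    "(complex \<Rightarrow> 'v \<Rightarrow> 'v) \<Rightarrow> 'g set \<Rightarrow> ('g \<Rightarrow> 'v::ab_group_add \<Rightarrow> 'v) \<Rightarrow> 'v set \<Rightarrow> bool" where
  "generated_by scale L \<rho> S \<longleftrightarrow> (\<forall>W. submodule scale L \<rho> W \<and> S \<subseteq> W \<longrightarrow> W = UNIV)"

text \<open>
  Irreducibility only refers to the operators \<open>\<rho> x\<close> for \<open>x \<in> L\<close>, so the bracket is not an argument;
  the zero module is not irreducible.
\<close>

definition irreducible_rep ::
    "(complex \<Rightarrow> 'v \<Rightarrow> 'v) \<Rightarrow> 'g set \<Rightarrow> ('g \<Rightarrow> 'v::ab_group_add \<Rightarrow> 'v) \<Rightarrow> bool" where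
  "irreducible_rep scale L \<rho> \<longleftrightarrow>
     (\<exists>v::'v. v \<noteq> 0) \<and> (\<forall>W. submodule scale L \<rho> W \<longrightarrow> W = {0} \<or> W = UNIV)"

definition is_direct_sum :: "'i set \<Rightarrow> ('i \<Rightarrow> 'v::ab_group_add set) \<Rightarrow> bool" where
  "is_direct_sum I V \<longleftrightarrow>
     (\<forall>v. \<exists>!f. (\<forall>i\<in>I. f i \<in> V i) \<and> (\<forall>i. i \<notin> I \<longrightarrow> f i = 0) \<and>
               finite {i. f i \<noteq> 0} \<and> v = (\<Sum>i | f i \<noteq> 0. f i))"


section \<open>Differential operators on the circle\<close>

definition falling :: "complex \<Rightarrow> nat \<Rightarrow> complex" where
  "falling \<mu> m = (\<Prod>i<m. \<mu> - of_nat i)"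

lemma falling_0 [simp]: "falling \<mu> 0 = 1"
  by (simp add: falling_def)

lemma falling_eq_gbinomial: "falling \<mu> m = fact m * (\<mu> gchoose m)"
  by (simp add: falling_def gbinomial_prod_rev atLeast0LessThan)

lemma falling_add: "falling \<mu> (a + b) = falling \<mu> a * falling (\<mu> - of_nat a) b"
  by (induction b) (simp_all add: falling_def algebra_simps)

lemma falling_vandermonde:
  "falling (a + b) r = (\<Sum>s\<le>r. of_nat (r choose s) * falling a s * falling b (r - s))"
proof -
  have "falling (a + b) r = (\<Sum>s\<le>r. fact r * ((a gchoose s) * (b gchoose (r - s))))"
    by (simp add: falling_eq_gbinomial gbinomial_Vandermonde[symmetric] atLeast0AtMost sum_distrib_left)
  also have "\<dots> = (\<Sum>s\<le>r. of_nat (r choose s) * falling a s * falling b (r - s))"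
    by (intro sum.cong) (simp_all add: falling_eq_gbinomial binomial_fact field_simps)
  finally show ?thesis .
qed

text \<open>The basis vector \<open>(m, r)\<close> of \<open>diff_op\<close> stands for \<open>t\<^sup>m \<partial>\<^sub>t\<^sup>r\<close>.\<close>

type_synonym diff_op = "(int \<times> nat) \<Rightarrow>\<^sub>0 complex"

abbreviation t_d :: "int \<Rightarrow> nat \<Rightarrow> diff_op" where
  "t_d m r \<equiv> bvec (m, r)"

text \<open>The Leibniz rule for \<open>t\<^sup>m\<^sup>1 \<partial>\<^sup>r\<^sup>1 \<cdot> t\<^sup>m\<^sup>2 \<partial>\<^sup>r\<^sup>2\<close>.\<close>

definition diff_op_mult :: "diff_op \<Rightarrow> diff_op \<Rightarrow> diff_op"  (infixl \<open>\<star>\<close> 70) where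
  "diff_op_mult = bilin_ext (\<lambda>(m1, r1) (m2, r2).
     \<Sum>s\<le>r1. pscale (of_nat (r1 choose s) * falling (of_int m2) s)
                     (t_d (m1 + m2 - int s) (r1 + r2 - s)))"

text \<open>
  The two lemmas at the end of this section show that \<open>diff_op\<close> with this product is the algebra
  of differential operators on \<open>\<complex>[t, t\<^sup>-\<^sup>1]\<close>; here \<open>bvec k\<close> stands for \<open>t\<^sup>k\<close>.
\<close>

definition diff_op_apply :: "diff_op \<Rightarrow> (int \<Rightarrow>\<^sub>0 complex) \<Rightarrow> (int \<Rightarrow>\<^sub>0 complex)" where
  "diff_op_apply = bilin_ext (\<lambda>(m, r) k. pscale (falling (of_int k) r) (bvec (m + k - int r)))"

lemma linear_eq_on_basis:
  assumes "Vector_Spaces.linear pscale s F" "Vector_Spaces.linear pscale s G"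
    and "\<And>b. F (bvec b) = G (bvec b)"
  shows "F x = G x"
proof -
  interpret F: Vector_Spaces.linear pscale s F by fact
  interpret G: Vector_Spaces.linear pscale s G by fact
  have "x = (\<Sum>b\<in>Poly_Mapping.keys x. pscale (Poly_Mapping.lookup x b) (bvec b))"
    by (auto intro!: poly_mapping_eqI
        simp: lookup_sum lookup_single when_def if_distrib in_keys_iff sum.delta cong: if_cong)
  then obtain A :: "'a set" and c where x: "x = (\<Sum>b\<in>A. pscale (c b) (bvec b))" by metis
  show ?thesis
    unfolding x F.sum G.sum F.scale G.scale assms(3) ..
qed

lemma linear_bilin_ext_right:
  fixes f :: "'a \<Rightarrow> 'b \<Rightarrow> ('c \<Rightarrow>\<^sub>0 complex)"
  shows "Vector_Spaces.linear pscale pscale (bilin_ext f x)"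
proof -
  interpret P: vector_space "pscale :: complex \<Rightarrow> ('c \<Rightarrow>\<^sub>0 complex) \<Rightarrow> _"
    by (rule vector_space_pscale)
  interpret Q: vector_space "pscale :: complex \<Rightarrow> ('b \<Rightarrow>\<^sub>0 complex) \<Rightarrow> _"
    by (rule vector_space_pscale)
  interpret L: Vector_Spaces.linear pscale pscale "lin_ext pscale (f a)" for a
    by (rule linear_lin_ext[OF vector_space_pscale])
  have eq: "bilin_ext f x y = (\<Sum>a\<in>Poly_Mapping.keys x.
      pscale (Poly_Mapping.lookup x a) (lin_ext pscale (f a) y))" for y
    by (simp add: bilin_ext_def lin_ext_def)
  show ?thesis
    by unfold_locales
      (simp_all add: eq L.add L.scale P.scale_right_distrib sum.distrib P.scale_sum_right
        mult.commute)
qed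

lemma linear_bilin_ext_left: "Vector_Spaces.linear pscale pscale (\<lambda>x. bilin_ext f x y)"
  unfolding bilin_ext_def by (rule linear_lin_ext[OF vector_space_pscale])

lemma bilin_ext_basis [simp]:
  fixes f :: "'a \<Rightarrow> 'b \<Rightarrow> ('c \<Rightarrow>\<^sub>0 complex)"
  shows "bilin_ext f (bvec a) (bvec b) = f a b"
proof -
  interpret P: vector_space "pscale :: complex \<Rightarrow> ('c \<Rightarrow>\<^sub>0 complex) \<Rightarrow> _"
    by (rule vector_space_pscale)
  show ?thesis
    by (simp only: bilin_ext_def lin_ext_single[OF vector_space_pscale] P.scale_one)
qed

lemma diff_op_apply_mult: "diff_op_apply (a \<star> b) f = diff_op_apply a (diff_op_apply b f)"
proof -
  interpret M1: Vector_Spaces.linear pscale pscale "\<lambda>a. a \<star> b" for b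
    unfolding diff_op_mult_def by (rule linear_bilin_ext_left)
  interpret M2: Vector_Spaces.linear pscale pscale "\<lambda>b. a \<star> b" for a
    unfolding diff_op_mult_def by (rule linear_bilin_ext_right)
  interpret A1: Vector_Spaces.linear pscale pscale "\<lambda>a. diff_op_apply a f" for f
    unfolding diff_op_apply_def by (rule linear_bilin_ext_left)
  interpret A2: Vector_Spaces.linear pscale pscale "\<lambda>f. diff_op_apply a f" for a
    unfolding diff_op_apply_def by (rule linear_bilin_ext_right)
  have *: "diff_op_apply (t_d m1 r1 \<star> t_d m2 r2) (bvec k)
      = diff_op_apply (t_d m1 r1) (diff_op_apply (t_d m2 r2) (bvec k))" for m1 r1 m2 r2 k
  proof -
    have c: "falling (of_int k) r2 * falling (of_int (m2 + k - int r2)) r1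
        = (\<Sum>s\<le>r1. of_nat (r1 choose s) * falling (of_int m2) s * falling (of_int k) (r1 + r2 - s))"
    proof -
      have "falling (of_int (m2 + k - int r2)) r1 = falling (of_int m2 + (of_int k - of_nat r2)) r1"
        by (simp add: algebra_simps)
      also have "\<dots> = (\<Sum>s\<le>r1. of_nat (r1 choose s) * falling (of_int m2) s
                              * falling (of_int k - of_nat r2) (r1 - s))"
        by (rule falling_vandermonde)
      finally show ?thesis
        by (auto simp: sum_distrib_left algebra_simps falling_add[of _ r2, symmetric] intro!: sum.cong)
    qed
    have "diff_op_apply (t_d m1 r1 \<star> t_d m2 r2) (bvec k)
        = (\<Sum>s\<le>r1. Poly_Mapping.single (m1 + m2 + k - int r1 - int r2)
            (of_nat (r1 choose s) * falling (of_int m2) s * falling (of_int k) (r1 + r2 - s)))"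
    proof -
      have e: "m1 + m2 - int s + k - int (r1 + r2 - s) = m1 + m2 + k - int r1 - int r2"
        if "s \<le> r1" for s using that by simp
      have s: "Poly_Mapping.single p (c::complex) = pscale c (bvec p)" for p :: "int \<times> nat" and c
        by simp
      show ?thesis
        unfolding diff_op_mult_def bilin_ext_basis prod.case A1.sum A1.scale
        by (intro sum.cong refl) (simp add: diff_op_apply_def e algebra_simps)
    qed
    also have "\<dots> = Poly_Mapping.single (m1 + m2 + k - int r1 - int r2)
                      (falling (of_int k) r2 * falling (of_int (m2 + k - int r2)) r1)"
      unfolding c by (induction rule: infinite_finite_induct[of _ "{..r1}"]) (simp_all add: single_add)
    also have "\<dots> = diff_op_apply (t_d m1 r1) (diff_op_apply (t_d m2 r2) (bvec k))"
    proof -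
      have "diff_op_apply (t_d m2 r2) (bvec k)
          = pscale (falling (of_int k) r2) (bvec (m2 + k - int r2))"
        by (simp add: diff_op_apply_def)
      then show ?thesis
        by (simp only: A2.scale) (simp add: diff_op_apply_def algebra_simps)
    qed
    finally show ?thesis .
  qed
  note comp = Vector_Spaces.linear_compose[unfolded o_def]
  have 1: "diff_op_apply (bvec p \<star> bvec q) f = diff_op_apply (bvec p) (diff_op_apply (bvec q) f)"
    for p q f
    by (rule linear_eq_on_basis[OF A2.linear_axioms comp[OF A2.linear_axioms A2.linear_axioms]])
      (metis * prod.collapse)
  have 2: "diff_op_apply (bvec p \<star> b) f = diff_op_apply (bvec p) (diff_op_apply b f)" for p b f
    by (rule linear_eq_on_basis[OF comp[OF M2.linear_axioms A1.linear_axioms]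
          comp[OF A1.linear_axioms A2.linear_axioms]]) (rule 1)
  show ?thesis
    by (rule linear_eq_on_basis[OF comp[OF M1.linear_axioms A1.linear_axioms] A1.linear_axioms])
      (rule 2)
qed

lemma diff_op_apply_faithful:
  assumes "\<And>f. diff_op_apply a f = 0"
  shows "a = 0"
proof (rule poly_mapping_eqI)
  fix p :: "int \<times> nat"
  define d where "d = fst p - int (snd p)"
  have zero: "(\<Sum>(m, r)\<in>Poly_Mapping.keys a.
      Poly_Mapping.lookup a (m, r) * (if m - int r = d then falling (of_int k) r else 0)) = 0" for k
  proof -
    have "Poly_Mapping.lookup (diff_op_apply a (bvec k)) (k + d) = 0"
      using assms by simp
    moreover have "Poly_Mapping.lookup (diff_op_apply a (bvec k)) (k + d)
      = (\<Sum>(m, r)\<in>Poly_Mapping.keys a.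
          Poly_Mapping.lookup a (m, r) * (if m - int r = d then falling (of_int k) r else 0))"
      unfolding diff_op_apply_def bilin_ext_def lin_ext_single[OF vector_space_pscale]
        lin_ext_def[of pscale _ a] lookup_sum
      by (intro sum.cong) (auto simp: lookup_single when_def)
    ultimately show ?thesis by simp
  qed
  have "Poly_Mapping.lookup a (d + int r, r) = 0" for r
  proof (induction r rule: less_induct)
    case (less r)
    have vanish: "falling (of_int (int r)) q = 0" if "r < q" for q
      using that by (auto simp: falling_def intro!: bexI[of _ r])
    have nz: "falling (of_int (int r)) r \<noteq> 0"
      by (auto simp: falling_def)
    have "(\<Sum>(m, q)\<in>Poly_Mapping.keys a. Poly_Mapping.lookup a (m, q) *
        (if m - int q = d then falling (of_int (int r)) q else 0))
      = (\<Sum>b\<in>Poly_Mapping.keys a. if b = (d + int r, r)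
           then Poly_Mapping.lookup a (d + int r, r) * falling (of_int (int r)) r else 0)"
    proof (intro sum.cong refl, clarify)
      fix m q
      consider "m - int q \<noteq> d" | "m = d + int q" "q < r" | "m = d + int q" "q = r"
        | "m = d + int q" "r < q" by linarith
      then show "Poly_Mapping.lookup a (m, q) *
          (if m - int q = d then falling (of_int (int r)) q else 0)
        = (if (m, q) = (d + int r, r)
           then Poly_Mapping.lookup a (d + int r, r) * falling (of_int (int r)) r else 0)"
        by cases (use less vanish in auto)
    qed
    with zero[of "int r"] have "(if (d + int r, r) \<in> Poly_Mapping.keys a
           then Poly_Mapping.lookup a (d + int r, r) * falling (of_int (int r)) r else 0) = 0"
      by (simp add: sum.delta)
    with nz show ?case by (auto simp: in_keys_iff split: if_splits)
  qed
  from this[of "snd p"] show "Poly_Mapping.lookup a p = Poly_Mapping.lookup 0 p"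
    by (simp add: d_def)
qed


section \<open>The Lie algebras of matrix differential operators\<close>

text \<open>\<open>Dop m r i j\<close> is \<open>t\<^sup>m \<partial>\<^sub>t\<^sup>r E\<^sub>i\<^sub>,\<^sub>j\<close> with \<open>1 \<le> i, j \<le> n\<close>, and \<open>Kap\<close> is \<open>\<kappa>\<close>.\<close>

datatype gl_hat_basis = Dop int nat nat nat | Kap

definition gl_hat :: "nat \<Rightarrow> (gl_hat_basis \<Rightarrow>\<^sub>0 complex) set" where
  "gl_hat n = {x. Poly_Mapping.keys x \<subseteq> {Dop m r i j |m r i j. i \<in> {1..n} \<and> j \<in> {1..n}} \<union> {Kap}}"

definition mat_elem :: "diff_op \<Rightarrow> nat \<Rightarrow> nat \<Rightarrow> (gl_hat_basis \<Rightarrow>\<^sub>0 complex)" where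
  "mat_elem a i j = lin_ext pscale (\<lambda>(m, r). bvec (Dop m r i j)) a"

fun gl_hat_bracket_basis :: "gl_hat_basis \<Rightarrow> gl_hat_basis \<Rightarrow> (gl_hat_basis \<Rightarrow>\<^sub>0 complex)" where
  "gl_hat_bracket_basis (Dop m1 r1 i1 j1) (Dop m2 r2 i2 j2) =
     (if j1 = i2 then mat_elem (t_d m1 r1 \<star> t_d m2 r2) i1 j2 else 0)
   - (if i1 = j2 then mat_elem (t_d m2 r2 \<star> t_d m1 r1) i2 j1 else 0)
   + (if i1 = j2 \<and> j1 = i2 \<and> int r1 + int r2 = m1 + m2
      then pscale ((-1) ^ r1 * fact r1 * fact r2 * (of_int m1 gchoose (r1 + r2 + 1))) (bvec Kap)
      else 0)"
| "gl_hat_bracket_basis Kap _ = 0"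
| "gl_hat_bracket_basis _ Kap = 0"

definition gl_hat_bracket ::
    "(gl_hat_basis \<Rightarrow>\<^sub>0 complex) \<Rightarrow> (gl_hat_basis \<Rightarrow>\<^sub>0 complex) \<Rightarrow> (gl_hat_basis \<Rightarrow>\<^sub>0 complex)" where
  "gl_hat_bracket = bilin_ext gl_hat_bracket_basis"

definition star :: "nat \<Rightarrow> nat \<Rightarrow> nat" where
  "star n i = n + 1 - i"

definition o_hat_gen :: "nat \<Rightarrow> nat \<Rightarrow> (nat \<Rightarrow> nat) \<Rightarrow> int \<Rightarrow> nat \<Rightarrow> nat \<Rightarrow> nat
    \<Rightarrow> (gl_hat_basis \<Rightarrow>\<^sub>0 complex)" where
  "o_hat_gen n \<epsilon> ell m r i j =
     mat_elem (t_d m (r + ell j)) i j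
   - pscale ((-1) ^ \<epsilon>)
       (mat_elem (pscale ((-1) ^ r) (t_d 0 r) \<star> t_d m (ell i)) (star n j) (star n i))"

definition o_hat :: "nat \<Rightarrow> nat \<Rightarrow> (nat \<Rightarrow> nat) \<Rightarrow> (gl_hat_basis \<Rightarrow>\<^sub>0 complex) set" where
  "o_hat n \<epsilon> ell = module.span pscale
     ({o_hat_gen n \<epsilon> ell m r i j |m r i j. i \<in> {1..n} \<and> j \<in> {1..n}} \<union> {bvec Kap})"


lemma o_hat_subset_gl_hat: "o_hat n \<epsilon> ell \<subseteq> gl_hat n"
proof -
  interpret P: vector_space "pscale :: complex \<Rightarrow> (gl_hat_basis \<Rightarrow>\<^sub>0 complex) \<Rightarrow> _"
    by (rule vector_space_pscale)
  have sub: "P.subspace (gl_hat n)"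
  proof (rule P.subspaceI)
    show "0 \<in> gl_hat n" by (simp add: gl_hat_def)
    show "x + y \<in> gl_hat n" if "x \<in> gl_hat n" "y \<in> gl_hat n" for x y
      using that Poly_Mapping.keys_add[of x y] unfolding gl_hat_def by blast
    show "pscale c x \<in> gl_hat n" if "x \<in> gl_hat n" for c x
    proof -
      have "Poly_Mapping.keys (pscale c x) \<subseteq> Poly_Mapping.keys x" by (auto simp: in_keys_iff)
      with that show ?thesis unfolding gl_hat_def by blast
    qed
  qed
  have mat: "mat_elem a i j \<in> gl_hat n" if "i \<in> {1..n}" "j \<in> {1..n}" for a i j
    unfolding mat_elem_def lin_ext_def
    by (intro P.subspace_sum[OF sub] P.subspace_scale[OF sub])
      (use that in \<open>auto simp: gl_hat_def split: prod.split\<close>)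
  have star: "star n i \<in> {1..n}" if "i \<in> {1..n}" for i
    using that by (auto simp: star_def)
  have "o_hat_gen n \<epsilon> ell m r i j \<in> gl_hat n" if "i \<in> {1..n}" "j \<in> {1..n}" for m r i j
    unfolding o_hat_gen_def
    by (intro P.subspace_diff[OF sub] P.subspace_scale[OF sub] mat star that)
  moreover have "bvec Kap \<in> gl_hat n" by (simp add: gl_hat_def)
  ultimately show ?thesis
    unfolding o_hat_def by (intro P.span_minimal sub) auto
qed


section \<open>The Lie algebra of infinite matrices\<close>

definition half_ints :: "real set" where
  "half_ints = {real_of_int k + 1/2 |k. True}"

text \<open>
  \<open>Einf l k\<close> is \<open>\<E>\<^sub>l\<^sub>,\<^sub>k\<close> for \<open>l, k \<in> half_ints\<close> (so the matrix unit in row \<open>l\<close> and column \<open>-k\<close>),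
  and \<open>Kap0\<close> is \<open>\<kappa>\<^sub>0\<close>.
\<close>

datatype gl_inf_basis = Einf real real | Kap0

definition gl_inf :: "(gl_inf_basis \<Rightarrow>\<^sub>0 complex) set" where
  "gl_inf = {x. Poly_Mapping.keys x \<subseteq> {Einf l k |l k. l \<in> half_ints \<and> k \<in> half_ints} \<union> {Kap0}}"

definition Hstep :: "real \<Rightarrow> complex" where
  "Hstep l = (if l > 0 then 1 else 0)"

fun gl_inf_bracket_basis :: "gl_inf_basis \<Rightarrow> gl_inf_basis \<Rightarrow> (gl_inf_basis \<Rightarrow>\<^sub>0 complex)" where
  "gl_inf_bracket_basis (Einf l1 l2) (Einf k1 k2) =
     (if l2 + k1 = 0 then bvec (Einf l1 k2) else 0)
   - (if k2 + l1 = 0 then bvec (Einf k1 l2) else 0)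
   + (if l1 + k2 = 0 \<and> l2 + k1 = 0
      then pscale (Hstep l1 * Hstep l2 - Hstep k1 * Hstep k2) (bvec Kap0) else 0)"
| "gl_inf_bracket_basis Kap0 _ = 0"
| "gl_inf_bracket_basis _ Kap0 = 0"

definition gl_inf_bracket ::
    "(gl_inf_basis \<Rightarrow>\<^sub>0 complex) \<Rightarrow> (gl_inf_basis \<Rightarrow>\<^sub>0 complex) \<Rightarrow> (gl_inf_basis \<Rightarrow>\<^sub>0 complex)" where
  "gl_inf_bracket = bilin_ext gl_inf_bracket_basis"

definition gl_inf_torus :: "(gl_inf_basis \<Rightarrow>\<^sub>0 complex) set" where
  "gl_inf_torus = module.span pscale ({bvec (Einf l (-l)) |l. l \<in> half_ints} \<union> {bvec Kap0})"

definition gl_inf_far :: "nat \<Rightarrow> (gl_inf_basis \<Rightarrow>\<^sub>0 complex) set" where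
  "gl_inf_far m = module.span pscale
     ({bvec (Einf l1 (-l2)) |l1 l2. l1 \<in> half_ints \<and> l2 \<in> half_ints \<and> l1 > real m \<and> l2 > real m} \<union>
      {bvec (Einf (-l1) l2) |l1 l2. l1 \<in> half_ints \<and> l2 \<in> half_ints \<and> l1 > real m \<and> l2 > real m})"

text \<open>
  Linear functionals on the torus, normalised to vanish off it, so that distinct elements
  are distinct functionals.
\<close>

definition torus_weights :: "((gl_inf_basis \<Rightarrow>\<^sub>0 complex) \<Rightarrow> complex) set" where
  "torus_weights = {\<chi>.
     (\<forall>x\<in>gl_inf_torus. \<forall>y\<in>gl_inf_torus. \<chi> (x + y) = \<chi> x + \<chi> y) \<and>
     (\<forall>c. \<forall>x\<in>gl_inf_torus. \<chi> (pscale c x) = c * \<chi> x) \<and>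
     (\<forall>x. x \<notin> gl_inf_torus \<longrightarrow> \<chi> x = 0)}"

definition weight_space ::
    "(complex \<Rightarrow> 'v \<Rightarrow> 'v) \<Rightarrow> ((gl_inf_basis \<Rightarrow>\<^sub>0 complex) \<Rightarrow> 'v::ab_group_add \<Rightarrow> 'v)
      \<Rightarrow> ((gl_inf_basis \<Rightarrow>\<^sub>0 complex) \<Rightarrow> complex) \<Rightarrow> 'v set" where
  "weight_space scale \<rho> \<chi> = {v. \<forall>h\<in>gl_inf_torus. \<rho> h v = scale (\<chi> h) v}"

definition weighted ::
    "(complex \<Rightarrow> 'v \<Rightarrow> 'v) \<Rightarrow> ((gl_inf_basis \<Rightarrow>\<^sub>0 complex) \<Rightarrow> 'v::ab_group_add \<Rightarrow> 'v) \<Rightarrow> bool" where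
  "weighted scale \<rho> \<longleftrightarrow> is_direct_sum torus_weights (weight_space scale \<rho>)"


section \<open>The representation by infinite matrices\<close>

text \<open>
  \<open>\<complex>[[x, y]]\<close> is rendered as \<open>complex fps fps\<close>, with \<open>x\<close> the inner and \<open>y\<close> the outer variable.
  By homogeneity \<open>z\<close> carries no information and is set to \<open>1\<close>; so \<open>gen_series \<iota>\<close> is the quotient
  of \<open>(1 + y)\<^sup>\<iota> (1 + x)\<^sup>-\<^sup>\<iota> - 1\<close> by \<open>x - y\<close>.
\<close>

definition xvar :: "complex fps fps" where "xvar = fps_const fps_X"
definition yvar :: "complex fps fps" where "yvar = fps_X"

definition binom_x :: "complex \<Rightarrow> complex fps fps" where
  "binom_x a = fps_const (fps_binomial a)"
definition binom_y :: "complex \<Rightarrow> complex fps fps" where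
  "binom_y a = Abs_fps (\<lambda>k. fps_const (a gchoose k))"

definition gen_series :: "complex \<Rightarrow> complex fps fps" where
  "gen_series \<iota> = (THE F. (xvar - yvar) * F = binom_y \<iota> * binom_x (-\<iota>) - 1)"

definition im_coeff :: "complex \<Rightarrow> nat \<Rightarrow> nat \<Rightarrow> complex" where
  "im_coeff \<iota> r1 r2 = fps_nth (fps_nth (gen_series \<iota>) r2) r1"

lemma gen_series_eq:
  "gen_series \<iota> = Abs_fps (\<lambda>k. - fps_binomial (-\<iota>) * fps_shift (Suc k) (fps_binomial \<iota>))"
    (is "_ = ?F")
  and gen_series: "(xvar - yvar) * gen_series \<iota> = binom_y \<iota> * binom_x (-\<iota>) - 1"
proof -
  have split: "fps_shift k (fps_binomial \<iota>)
      = fps_const (\<iota> gchoose k) + fps_X * fps_shift (Suc k) (fps_binomial \<iota>)" for k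
  proof (rule fps_ext)
    fix i show "fps_nth (fps_shift k (fps_binomial \<iota>)) i
      = fps_nth (fps_const (\<iota> gchoose k) + fps_X * fps_shift (Suc k) (fps_binomial \<iota>)) i"
      by (cases i) simp_all
  qed
  have inv: "fps_binomial (-\<iota>) * fps_binomial \<iota> = 1"
    using fps_binomial_add_mult[of "-\<iota>" \<iota>] by simp
  have F: "(xvar - yvar) * ?F = binom_y \<iota> * binom_x (-\<iota>) - 1"
  proof (rule fps_ext)
    fix k
    show "fps_nth ((xvar - yvar) * ?F) k = fps_nth (binom_y \<iota> * binom_x (-\<iota>) - 1) k"
    proof (cases k)
      case 0
      show ?thesis
        using split[of 0] inv
        by (simp add: 0 xvar_def yvar_def binom_x_def binom_y_def left_diff_distrib) algebra
    next
      case (Suc k')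
      show ?thesis
        using split[of k]
        by (simp add: Suc xvar_def yvar_def binom_x_def binom_y_def left_diff_distrib algebra_simps)
    qed
  qed
  have nz: "xvar - yvar \<noteq> 0"
  proof
    assume "xvar - yvar = 0"
    then have "fps_nth (xvar - yvar) 1 = 0" by simp
    then show False by (simp add: xvar_def yvar_def)
  qed
  show eq: "gen_series \<iota> = ?F"
    unfolding gen_series_def
  proof (rule the_equality)
    show "(xvar - yvar) * ?F = binom_y \<iota> * binom_x (-\<iota>) - 1" by (rule F)
  next
    fix G assume "(xvar - yvar) * G = binom_y \<iota> * binom_x (-\<iota>) - 1"
    with F have "(xvar - yvar) * G = (xvar - yvar) * ?F" by simp
    with nz show "G = ?F" by simp
  qed
  show "(xvar - yvar) * gen_series \<iota> = binom_y \<iota> * binom_x (-\<iota>) - 1"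
    unfolding eq by (rule F)
qed

text \<open>
  The sum over all integers is \<open>Sum_any\<close>, the sum of the nonzero terms.  Under the hypotheses of
  the theorem there are only finitely many of them, see \<open>finite_support\<close> below.
\<close>

fun sigma_basis ::
    "nat \<Rightarrow> complex \<Rightarrow> (complex \<Rightarrow> 'v \<Rightarrow> 'v)
      \<Rightarrow> ((gl_inf_basis \<Rightarrow>\<^sub>0 complex) \<Rightarrow> 'v::ab_group_add \<Rightarrow> 'v) \<Rightarrow> gl_hat_basis \<Rightarrow> 'v \<Rightarrow> 'v" where
  "sigma_basis n \<iota> scale \<rho> (Dop m r i j) v =
     Sum_any (\<lambda>l::int. scale (falling (\<iota> - of_int l) r)
       (\<rho> (bvec (Einf (real_of_int (m - int r - l) * real n + real i - 1/2)
                       (real_of_int l * real n - real j + 1/2))) v))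
   + scale (if i = j \<and> int r = m then fact r * im_coeff \<iota> 0 r else 0) (\<rho> (bvec Kap0) v)"
| "sigma_basis n \<iota> scale \<rho> Kap v = \<rho> (bvec Kap0) v"

definition sigma ::
    "nat \<Rightarrow> complex \<Rightarrow> (complex \<Rightarrow> 'v \<Rightarrow> 'v)
      \<Rightarrow> ((gl_inf_basis \<Rightarrow>\<^sub>0 complex) \<Rightarrow> 'v::ab_group_add \<Rightarrow> 'v)
      \<Rightarrow> (gl_hat_basis \<Rightarrow>\<^sub>0 complex) \<Rightarrow> 'v \<Rightarrow> 'v" where
  "sigma n \<iota> scale \<rho> x v = lin_ext scale (\<lambda>b. sigma_basis n \<iota> scale \<rho> b v) x"

lemma finite_support:
  assumes "n \<ge> 1" "i \<ge> 1" "j \<ge> 1" "lie_rep scale gl_inf gl_inf_bracket \<rho>"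
    and "generated_by scale gl_inf \<rho> M0"
    and far: "\<forall>x\<in>gl_inf_far m. \<forall>v\<in>M0. \<rho> x v = 0"
  shows "finite {l::int. \<rho> (bvec (Einf (real_of_int (k - l) * real n + real i - 1/2)
                                     (real_of_int l * real n - real j + 1/2))) v \<noteq> 0}"
proof -
  interpret V: vector_space scale
    using assms(4) by (simp add: lie_rep_def)
  interpret P: vector_space "pscale :: complex \<Rightarrow> (gl_inf_basis \<Rightarrow>\<^sub>0 complex) \<Rightarrow> _"
    by (rule vector_space_pscale)
  have lin: "Vector_Spaces.linear scale scale (\<rho> x)" if "x \<in> gl_inf" for x
    using assms(4) that by (simp add: lie_rep_def)
  have hom: "module_hom scale scale (\<rho> x)" if "x \<in> gl_inf" for x
    using lin[OF that] by (simp add: Vector_Spaces.linear_def)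
  note ladd = module_hom.add[OF hom] and lscale = module_hom.scale[OF hom]
    and lzero = module_hom.zero[OF hom]
  have radd: "\<rho> (x + y) v = \<rho> x v + \<rho> y v" if "x \<in> gl_inf" "y \<in> gl_inf" for x y v
    using assms(4) that by (simp add: lie_rep_def)
  have rscale: "\<rho> (pscale c x) v = scale c (\<rho> x v)" if "x \<in> gl_inf" for c x v
    using assms(4) that by (simp add: lie_rep_def)
  have rbr: "\<rho> (gl_inf_bracket x y) v = \<rho> x (\<rho> y v) - \<rho> y (\<rho> x v)"
    if "x \<in> gl_inf" "y \<in> gl_inf" for x y v
    using assms(4) that by (simp add: lie_rep_def)
  have Ein: "bvec (Einf a b) \<in> gl_inf" if "a \<in> half_ints" "b \<in> half_ints" for a b
    using that by (auto simp: gl_inf_def)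
  have zin: "0 \<in> gl_inf"
    by (simp add: gl_inf_def)
  have r0: "\<rho> 0 v = 0" for v
    using rscale[OF zin, of 0 v] by simp
  have neg: "- a \<in> half_ints" if "a \<in> half_ints" for a
  proof -
    from that obtain k where "a = real_of_int k + 1/2" by (auto simp: half_ints_def)
    then have "- a = real_of_int (- k - 1) + 1/2" by simp
    then show ?thesis unfolding half_ints_def by blast
  qed
  define killed where "killed N v \<longleftrightarrow>
    (\<forall>a\<in>half_ints. \<forall>b\<in>half_ints. (a > N \<and> b < -N \<or> a < -N \<and> b > N) \<longrightarrow> \<rho> (bvec (Einf a b)) v = 0)"
    for N :: real and v
  have mono: "killed N' v" if "killed N v" "N \<le> N'" for N N' v
    unfolding killed_def
  proof (intro ballI impI)
    fix a b assume "a \<in> half_ints" "b \<in> half_ints" "a > N' \<and> b < -N' \<or> a < -N' \<and> b > N'"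
    moreover from this \<open>N \<le> N'\<close> have "a > N \<and> b < -N \<or> a < -N \<and> b > N" by linarith
    ultimately show "\<rho> (bvec (Einf a b)) v = 0" using that(1) by (auto simp: killed_def)
  qed
  define W where "W = {v. \<exists>N. killed N v}"
  have sub: "V.subspace W"
  proof (rule V.subspaceI)
    show "0 \<in> W" by (auto simp: W_def killed_def lzero Ein)
  next
    fix v w assume "v \<in> W" "w \<in> W"
    then obtain N N' where "killed N v" "killed N' w" by (auto simp: W_def)
    then have "killed (max N N') v" "killed (max N N') w" by (auto intro: mono)
    then have "killed (max N N') (v + w)" by (simp add: killed_def ladd Ein)
    then show "v + w \<in> W" by (auto simp: W_def)
  next
    fix c v assume "v \<in> W"
    then show "scale c v \<in> W" by (auto simp: W_def killed_def lscale Ein)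
  qed
  have basis: "\<rho> (bvec e) v \<in> W" if "bvec e \<in> gl_inf" "v \<in> W" for e v
  proof -
    from that obtain N where N: "killed N v" by (auto simp: W_def)
    obtain N' where N': "N' \<ge> N"
      "\<And>a b. a \<in> half_ints \<Longrightarrow> b \<in> half_ints \<Longrightarrow> a > N' \<and> b < -N' \<or> a < -N' \<and> b > N' \<Longrightarrow>
        gl_inf_bracket (bvec (Einf a b)) (bvec e) = 0"
    proof (cases e)
      case (Einf p q)
      show ?thesis
        by (rule that[of "max N (\<bar>p\<bar> + \<bar>q\<bar>)"]) (auto simp: gl_inf_bracket_def Einf)
    next
      case Kap0
      show ?thesis by (rule that[of N]) (auto simp: gl_inf_bracket_def Kap0)
    qed
    have "killed N' (\<rho> (bvec e) v)"
      unfolding killed_def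
    proof (intro ballI impI)
      fix a b assume ab: "a \<in> half_ints" "b \<in> half_ints" "a > N' \<and> b < -N' \<or> a < -N' \<and> b > N'"
      have "\<rho> (bvec (Einf a b)) v = 0"
        using mono[OF N N'(1)] ab by (auto simp: killed_def)
      then show "\<rho> (bvec (Einf a b)) (\<rho> (bvec e) v) = 0"
        using rbr[OF Ein[OF ab(1,2)] that(1), of v] N'(2)[OF ab] that(1) by (simp add: r0 lzero)
    qed
    then show ?thesis by (auto simp: W_def)
  qed
  have act: "\<rho> x v \<in> W" if "x \<in> gl_inf" "v \<in> W" for x v
  proof -
    have "x = (\<Sum>b\<in>Poly_Mapping.keys x. pscale (Poly_Mapping.lookup x b) (bvec b))"
      by (auto intro!: poly_mapping_eqI
          simp: lookup_sum lookup_single when_def if_distrib in_keys_iff sum.delta cong: if_cong)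
    moreover have "(\<Sum>b\<in>A. pscale (Poly_Mapping.lookup x b) (bvec b)) \<in> gl_inf \<and>
        \<rho> (\<Sum>b\<in>A. pscale (Poly_Mapping.lookup x b) (bvec b)) v \<in> W"
      if "finite A" "A \<subseteq> Poly_Mapping.keys x" for A
      using that
    proof (induction A)
      case empty
      then show ?case using sub by (simp add: zin r0 V.subspace_0)
    next
      case (insert b A)
      have b: "bvec b \<in> gl_inf" "pscale c (bvec b) \<in> gl_inf" for c
        using insert.prems \<open>x \<in> gl_inf\<close> by (auto simp: gl_inf_def)
      have "y + z \<in> gl_inf" if "y \<in> gl_inf" "z \<in> gl_inf" for y z
        using that Poly_Mapping.keys_add[of y z] unfolding gl_inf_def by blast
      with insert b show ?case
        using basis[OF b(1) \<open>v \<in> W\<close>]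
        by (simp add: radd rscale V.subspace_add[OF sub] V.subspace_scale[OF sub]
            del: pscale_single)
    qed
    ultimately show ?thesis by (metis finite_keys order_refl)
  qed
  have "M0 \<subseteq> W"
  proof
    fix v assume v: "v \<in> M0"
    have "killed (real m) v"
      unfolding killed_def
    proof (intro ballI impI)
      fix a b assume ab: "a \<in> half_ints" "b \<in> half_ints"
        "a > real m \<and> b < - real m \<or> a < - real m \<and> b > real m"
      have "bvec (Einf a b) \<in> gl_inf_far m"
        unfolding gl_inf_far_def
      proof (rule P.span_base)
        from ab(3) show "bvec (Einf a b) \<in>
          {bvec (Einf l1 (-l2)) |l1 l2. l1 \<in> half_ints \<and> l2 \<in> half_ints \<and> l1 > real m \<and> l2 > real m} \<union>
          {bvec (Einf (-l1) l2) |l1 l2. l1 \<in> half_ints \<and> l2 \<in> half_ints \<and> l1 > real m \<and> l2 > real m}"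
          (is "_ \<in> ?A \<union> ?B")
        proof
          assume "a > real m \<and> b < - real m"
          then have "bvec (Einf a (- (- b))) \<in> ?A" using ab(1,2) neg by force
          then show ?thesis by simp
        next
          assume "a < - real m \<and> b > real m"
          then have "bvec (Einf (- (- a)) b) \<in> ?B" using ab(1,2) neg by force
          then show ?thesis by simp
        qed
      qed
      with far v show "\<rho> (bvec (Einf a b)) v = 0" by blast
    qed
    then show "v \<in> W" by (auto simp: W_def)
  qed
  with sub act have "W = UNIV"
    using assms(5) unfolding generated_by_def submodule_def by blast
  then obtain N where N: "killed N v" by (auto simp: W_def)
  define B where "B = \<bar>N\<bar> + \<bar>real_of_int k\<bar> * real n + real i + real j"
  have far_l: "\<rho> (bvec (Einf (real_of_int (k - l) * real n + real i - 1/2)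
                    (real_of_int l * real n - real j + 1/2))) v = 0"
    if l: "\<bar>real_of_int l\<bar> > B" for l
  proof -
    let ?a = "real_of_int (k - l) * real n + real i - 1/2"
    let ?b = "real_of_int l * real n - real j + 1/2"
    have "?a = real_of_int ((k - l) * int n + int i - 1) + 1/2"
      "?b = real_of_int (l * int n - int j) + 1/2" by simp_all
    then have h: "?a \<in> half_ints" "?b \<in> half_ints" unfolding half_ints_def by blast+
    have ln: "\<bar>real_of_int l * real n\<bar> \<ge> \<bar>real_of_int l\<bar>"
      using \<open>n \<ge> 1\<close> mult_left_mono[of 1 "real n" "\<bar>real_of_int l\<bar>"] by (simp add: abs_mult)
    have kn: "\<bar>real_of_int k * real n\<bar> = \<bar>real_of_int k\<bar> * real n" by (simp add: abs_mult)
    have "?a > N \<and> ?b < -N \<or> ?a < -N \<and> ?b > N"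
      using l ln kn \<open>i \<ge> 1\<close> \<open>j \<ge> 1\<close> unfolding B_def by (auto simp: left_diff_distrib)
    with N h show ?thesis by (auto simp: killed_def)
  qed
  have "{l::int. \<rho> (bvec (Einf (real_of_int (k - l) * real n + real i - 1/2)
            (real_of_int l * real n - real j + 1/2))) v \<noteq> 0} \<subseteq> {- \<lceil>B\<rceil> .. \<lceil>B\<rceil>}"
  proof
    fix l assume "l \<in> {l::int. \<rho> (bvec (Einf (real_of_int (k - l) * real n + real i - 1/2)
            (real_of_int l * real n - real j + 1/2))) v \<noteq> 0}"
    with far_l[of l] have "\<bar>real_of_int l\<bar> \<le> B" by fastforce
    then show "l \<in> {- \<lceil>B\<rceil> .. \<lceil>B\<rceil>}" by (auto simp: abs_le_iff) linarith+
  qed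
  then show ?thesis by (rule finite_subset) simp
qed

end

theory Submission
  imports Defs
begin

text \<open>
  Irreducibility is a statement about invariant subspaces, and the two algebras turn out to have
  the same ones.  That a subspace invariant under the infinite matrices is invariant under the
  differential operators is clear, because the latter act on each vector by finite sums of
  matrix units (\<open>gl_inf_submodule_imp_o_hat_submodule\<close>).

  For the converse, fix a vector \<open>w\<close> of a subspace \<open>W\<close> invariant under the differential operators,
  and think of the matrix unit with column index \<open>l n - j + 1/2\<close> as acting on the monomial
  \<open>t\<close> to the power \<open>\<iota> - l\<close> times \<open>e\<^sub>j\<close>.  Put \<open>m = p + r + \<ell>\<^sub>j\<close> in the generator of the orthogonal
  algebra, so that the degree \<open>p\<close> of its first summand does not depend on \<open>r\<close>.  This summand
  multiplies the monomial by the falling factorial of \<open>\<iota> - l\<close> of order \<open>r + \<ell>\<^sub>j\<close>, which splits into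
  the one of order \<open>\<ell>\<^sub>j\<close> and the falling factorial of order \<open>r\<close> at \<open>\<iota> - l - \<ell>\<^sub>j\<close>.  By the Leibniz
  rule, Vandermonde's identity and \<open>falling_reflect\<close>, the second summand has the same shape, with
  falling factorials of order \<open>r\<close> at points of \<open>- \<iota> + \<int>\<close>.  Up to a multiple of the central element,
  which the algebra itself contains, the generator therefore acts on \<open>w\<close> as a finite sum of
  vectors \<open>w\<^sub>k\<close> independent of \<open>r\<close>, weighted by falling factorials of order \<open>r\<close> at nodes \<open>x\<^sub>k\<close>
  (\<open>sigma_o_hat_gen\<close>).

  Since \<open>2 \<iota>\<close> is not an integer, the cosets \<open>\<iota> + \<int>\<close> and \<open>- \<iota> + \<int>\<close> are disjoint and all nodes are
  distinct.  The falling factorials form a basis of the polynomials, so by interpolation every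
  single \<open>w\<^sub>k\<close> lies in \<open>W\<close> (\<open>falling_moments_in_subspace\<close>).  Among them, for suitable \<open>p\<close>, \<open>i\<close>, \<open>j\<close>,
  is the image of \<open>w\<close> under any prescribed matrix unit, multiplied by the falling factorial of
  \<open>\<iota> - l\<close> of order \<open>\<ell>\<^sub>j\<close>, which is nonzero because \<open>\<iota>\<close> is not an integer.
\<close>

section \<open>Subspaces and linear extensions\<close>

text \<open>The sum of a family with infinite support is \<open>0\<close>, so it lies in \<open>W\<close> as well.\<close>

lemma subspace_Sum_any:
  assumes "vector_space scale" "module.subspace scale W" "\<And>l. f l \<in> W"
  shows "Sum_any f \<in> W"
proof -
  interpret V: vector_space scale by fact
  show ?thesis
    unfolding Sum_any.expand_set using assms(2,3) by (intro V.subspace_sum)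
qed

lemma subspace_lin_ext:
  assumes "vector_space scale" "module.subspace scale W"
    and "\<And>b. b \<in> Poly_Mapping.keys x \<Longrightarrow> f b \<in> W"
  shows "lin_ext scale f x \<in> W"
proof -
  interpret V: vector_space scale by fact
  show ?thesis
    unfolding lin_ext_def using assms(2,3) by (intro V.subspace_sum V.subspace_scale)
qed

lemma lie_rep_gl_inf_eq_lin_ext:
  assumes "lie_rep scale gl_inf br \<rho>" "x \<in> gl_inf"
  shows "\<rho> x v = lin_ext scale (\<lambda>b. \<rho> (bvec b) v) x"
proof -
  have vs: "vector_space scale"
    and radd: "\<And>x y. x \<in> gl_inf \<Longrightarrow> y \<in> gl_inf \<Longrightarrow> \<rho> (x + y) v = \<rho> x v + \<rho> y v"
    and rscale: "\<And>c x. x \<in> gl_inf \<Longrightarrow> \<rho> (pscale c x) v = scale c (\<rho> x v)"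
    using assms(1) by (auto simp: lie_rep_def)
  interpret V: vector_space scale by fact
  have "pscale 0 0 = (0 :: gl_inf_basis \<Rightarrow>\<^sub>0 complex)"
    by (rule poly_mapping_eqI) simp
  then have zero: "\<rho> 0 v = 0"
    using rscale[of 0 0] by (simp add: gl_inf_def)
  have b: "bvec b \<in> gl_inf" "pscale c (bvec b) \<in> gl_inf" if "b \<in> Poly_Mapping.keys x" for b c
    using that assms(2) by (auto simp: gl_inf_def)
  have add_mem: "y + z \<in> gl_inf" if "y \<in> gl_inf" "z \<in> gl_inf" for y z
    using that Poly_Mapping.keys_add[of y z] unfolding gl_inf_def by blast
  have partial: "(\<Sum>b\<in>A. pscale (Poly_Mapping.lookup x b) (bvec b)) \<in> gl_inf \<and>
      \<rho> (\<Sum>b\<in>A. pscale (Poly_Mapping.lookup x b) (bvec b)) v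
        = (\<Sum>b\<in>A. scale (Poly_Mapping.lookup x b) (\<rho> (bvec b) v))"
    if "finite A" "A \<subseteq> Poly_Mapping.keys x" for A
    using that
  proof (induction A)
    case empty
    then show ?case by (simp add: zero gl_inf_def)
  next
    case (insert b A)
    with b[of b] show ?case
      by (simp add: add_mem radd rscale del: pscale_single)
  qed
  have expand: "(\<Sum>b\<in>Poly_Mapping.keys x. pscale (Poly_Mapping.lookup x b) (bvec b)) = x"
    by (auto intro!: poly_mapping_eqI
        simp: lookup_sum lookup_single when_def if_distrib in_keys_iff sum.delta cong: if_cong)
  show ?thesis
    using partial[of "Poly_Mapping.keys x", unfolded expand] by (simp add: lin_ext_def)
qed

section \<open>Falling factorials\<close>

lemma falling_nonzero:
  assumes "\<mu> \<notin> \<int>"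
  shows "falling \<mu> r \<noteq> 0"
  using assms by (auto simp: falling_def)

text \<open>
  Both sides are the product of \<open>- x - 1, \<dots>, - x - r\<close>.  In the adjoint operator
  \<open>(- \<partial>)\<^sup>r t\<^sup>m\<close> with \<open>m - r\<close> fixed, the argument of the falling factorial moves with \<open>r\<close>; this
  identity replaces it by a point that does not.
\<close>

lemma falling_reflect:
  "(-1) ^ r * falling (x + of_nat r) r = falling (- x - 1) r"
proof (induction r arbitrary: x)
  case 0
  then show ?case by simp
next
  case (Suc r)
  have "falling (x + of_nat (Suc r)) (Suc r) = falling (x + 1 + of_nat r) r * (x + 1)"
    by (simp add: falling_def algebra_simps)
  then have "(-1) ^ Suc r * falling (x + of_nat (Suc r)) (Suc r)
      = (- x - 1) * ((-1) ^ r * falling (x + 1 + of_nat r) r)"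
    by (simp add: algebra_simps)
  also have "\<dots> = (- x - 1) * falling (- x - 1 - 1) r"
    unfolding Suc.IH by (simp add: algebra_simps)
  also have "\<dots> = falling (- x - 1) (Suc r)"
    using falling_add[of "- x - 1" 1 r] by (simp add: falling_def)
  finally show ?case .
qed

text \<open>
  Interpolation at the distinct nodes \<open>x k\<close>, done one node at a time.  Because
  \<open>falling \<mu> (Suc r) = falling \<mu> r * (\<mu> - r)\<close>, multiplying every \<open>w k\<close> by \<open>x k - x a\<close> turns moments
  into combinations of moments, and it eliminates the term of the node \<open>x a\<close>.
\<close>

lemma falling_moments_in_subspace:
  fixes scale :: "complex \<Rightarrow> 'v \<Rightarrow> 'v::ab_group_add"
  assumes vs: "vector_space scale" and sub: "module.subspace scale W"
    and "finite I" "inj_on x I"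
    and "\<And>r. (\<Sum>k\<in>I. scale (falling (x k) r) (w k)) \<in> W"
    and "k \<in> I"
  shows "w k \<in> W"
  using assms(3-6)
proof (induction I arbitrary: w k)
  case empty
  then show ?case by simp
next
  case (insert a I)
  interpret V: vector_space scale by fact
  have step: "(\<Sum>k\<in>I. scale (falling (x k) r) (scale (x k - x a) (w k))) \<in> W" for r
  proof -
    let ?M = "\<lambda>r. \<Sum>k\<in>insert a I. scale (falling (x k) r) (w k)"
    have "(\<Sum>k\<in>I. scale (falling (x k) r) (scale (x k - x a) (w k)))
        = (\<Sum>k\<in>insert a I. scale (falling (x k) r) (scale (x k - x a) (w k)))"
      using insert.hyps by simp
    also have "\<dots> = ?M (Suc r) + scale (of_nat r - x a) (?M r)"
    proof -
      have "falling \<mu> r * (\<mu> - x a) = falling \<mu> (Suc r) + (of_nat r - x a) * falling \<mu> r" for \<mu>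
        by (simp add: falling_def algebra_simps)
      then show ?thesis
        by (simp only: V.scale_sum_right sum.distrib[symmetric] V.scale_scale
            V.scale_left_distrib[symmetric])
    qed
    also have "\<dots> \<in> W"
      using insert.prems(2) by (intro V.subspace_add V.subspace_scale sub)
    finally show ?thesis .
  qed
  have rest: "w k \<in> W" if "k \<in> I" for k
  proof -
    have "scale (x k - x a) (w k) \<in> W"
      using insert.prems(1) by (intro insert.IH[OF _ step that]) (auto simp: inj_on_def)
    moreover have "x k - x a \<noteq> 0"
      using insert.prems(1) insert.hyps that by (auto simp: inj_on_def)
    ultimately show ?thesis
      using V.subspace_scale[OF sub, of "scale (x k - x a) (w k)" "1 / (x k - x a)"] by simp
  qed
  have "w a = (\<Sum>k\<in>insert a I. scale (falling (x k) 0) (w k)) - (\<Sum>k\<in>I. w k)"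
    using insert.hyps by simp
  also have "\<dots> \<in> W"
    using rest by (intro V.subspace_diff[OF sub insert.prems(2)] V.subspace_sum sub)
  finally show ?case
    using insert.prems(3) rest by auto
qed

section \<open>Matrix units indexed by degree\<close>

text \<open>
  With row \<open>s n + i - 1/2\<close> identified with \<open>t\<close> to the power \<open>\<iota> + s\<close> times \<open>e\<^sub>i\<close>, this matrix unit
  takes exponent \<open>\<iota> - l\<close> and vector \<open>e\<^sub>j\<close> to exponent \<open>\<iota> - l + p\<close> and vector \<open>e\<^sub>i\<close>; so \<open>p\<close> is the
  degree of the differential operators in which it occurs.
\<close>

abbreviation graded_unit :: "nat \<Rightarrow> int \<Rightarrow> nat \<Rightarrow> nat \<Rightarrow> int \<Rightarrow> (gl_inf_basis \<Rightarrow>\<^sub>0 complex)" where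
  "graded_unit n p i j l \<equiv>
     bvec (Einf (real_of_int (p - l) * real n + real i - 1/2)
                (real_of_int l * real n - real j + 1/2))"

lemma graded_unit_index_half_ints:
  "real_of_int q * real n + real i - 1/2 \<in> half_ints"
  "real_of_int l * real n - real j + 1/2 \<in> half_ints"
proof -
  have "real_of_int q * real n + real i - 1/2 = real_of_int (q * int n + int i - 1) + 1/2"
    "real_of_int l * real n - real j + 1/2 = real_of_int (l * int n - int j) + 1/2"
    by simp_all
  then show "real_of_int q * real n + real i - 1/2 \<in> half_ints"
    "real_of_int l * real n - real j + 1/2 \<in> half_ints"
    unfolding half_ints_def by blast+
qed

lemma graded_unit_exhausts:
  assumes "n \<ge> 1" "a \<in> half_ints" "b \<in> half_ints"
  obtains p i j l where "i \<in> {1..n}" "j \<in> {1..n}" "bvec (Einf a b) = graded_unit n p i j l"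
proof -
  from assms obtain k k' where a: "a = real_of_int k + 1/2" and b: "b = real_of_int k' + 1/2"
    by (auto simp: half_ints_def)
  \<comment> \<open>Here \<open>k' = l n - j\<close> with \<open>1 \<le> j \<le> n\<close>, so \<open>l\<close> is one more than the quotient of \<open>k'\<close> by \<open>n\<close>.\<close>
  define l where "l = k' div int n + 1"
  define j where "j = nat (int n - k' mod int n)"
  define i where "i = nat (k mod int n + 1)"
  define p where "p = k div int n + l"
  have m: "0 \<le> k mod int n" "k mod int n < int n" "0 \<le> k' mod int n" "k' mod int n < int n"
    using assms(1) by auto
  have ji: "int j = int n - k' mod int n" "int i = k mod int n + 1"
    using m by (auto simp: j_def i_def)
  have "k = (p - l) * int n + int i - 1"
    unfolding ji p_def by simp
  then have ea: "a = real_of_int (p - l) * real n + real i - 1/2"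
    unfolding a by simp
  have "k' = l * int n - int j"
    unfolding ji l_def using div_mult_mod_eq[of k' "int n"] by (simp add: algebra_simps)
  then have eb: "b = real_of_int l * real n - real j + 1/2"
    unfolding b by simp
  have "i \<in> {1..n}" "j \<in> {1..n}"
    using m ji by (simp_all, linarith+)
  then show ?thesis
    using that ea eb by blast
qed

section \<open>Action of the generators on a vector\<close>

lemma linear_sigma:
  assumes "vector_space scale"
  shows "Vector_Spaces.linear pscale scale (\<lambda>x. sigma n \<iota> scale \<rho> x v)"
  unfolding sigma_def by (rule linear_lin_ext[OF assms])

lemma mat_elem_bvec [simp]: "mat_elem (t_d m r) i j = bvec (Dop m r i j)"
  by (simp add: mat_elem_def lin_ext_single[OF vector_space_pscale])

lemma sigma_bvec [simp]:
  assumes "vector_space scale"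
  shows "sigma n \<iota> scale \<rho> (bvec b) v = sigma_basis n \<iota> scale \<rho> b v"
proof -
  interpret V: vector_space scale by fact
  show ?thesis by (simp add: sigma_def lin_ext_single[OF assms])
qed

text \<open>
  The formulas of this section are modulo the line spanned by \<open>\<rho> (bvec Kap0) v\<close>: a subspace
  invariant under the central element cannot see the coefficient \<open>c\<close>.
\<close>

lemma sigma_basis_Dop_finite:
  fixes scale :: "complex \<Rightarrow> 'v \<Rightarrow> 'v::ab_group_add"
  assumes "vector_space scale" "finite S"
    and "{l. \<rho> (graded_unit n (m - int r) i j l) v \<noteq> 0} \<subseteq> S"
  obtains c where "sigma_basis n \<iota> scale \<rho> (Dop m r i j) v
    = (\<Sum>l\<in>S. scale (falling (\<iota> - of_int l) r) (\<rho> (graded_unit n (m - int r) i j l) v))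
      + scale c (\<rho> (bvec Kap0) v)"
proof -
  interpret V: vector_space scale by fact
  have supp: "{l. scale (falling (\<iota> - of_int l) r) (\<rho> (graded_unit n (m - int r) i j l) v) \<noteq> 0} \<subseteq> S"
    using assms(3) by auto
  from that[of "if i = j \<and> int r = m then fact r * im_coeff \<iota> 0 r else 0"] show ?thesis
    by (simp only: sigma_basis.simps Sum_any.expand_superset[OF assms(2) supp])
qed

text \<open>
  The two falling factorials come from differentiating \<open>t\<close> to the power \<open>\<iota> - l\<close> first \<open>q\<close> times
  and then, after multiplication by \<open>t\<^sup>m\<close>, another \<open>r\<close> times.  The representation is given on
  monomials with all derivatives on the right, so the product is expanded by the Leibniz rule
  and resummed by Vandermonde's identity.
\<close>

lemma sigma_diff_op_product:
  fixes scale :: "complex \<Rightarrow> 'v \<Rightarrow> 'v::ab_group_add"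
  assumes vs: "vector_space scale" and "finite S"
    and supp: "{l. \<rho> (graded_unit n (m - int r - int q) i j l) v \<noteq> 0} \<subseteq> S"
  obtains c where "sigma n \<iota> scale \<rho> (mat_elem (pscale d (t_d 0 r) \<star> t_d m q) i j) v
    = (\<Sum>l\<in>S. scale (d * falling (\<iota> - of_int l) q * falling (of_int m + (\<iota> - of_int l - of_nat q)) r)
         (\<rho> (graded_unit n (m - int r - int q) i j l) v)) + scale c (\<rho> (bvec Kap0) v)"
proof -
  interpret V: vector_space scale by fact
  interpret L: Vector_Spaces.linear pscale scale "\<lambda>x. sigma n \<iota> scale \<rho> x v"
    by (rule linear_sigma[OF vs])
  interpret M: Vector_Spaces.linear pscale pscale "\<lambda>a. mat_elem a i j"
    unfolding mat_elem_def by (rule linear_lin_ext[OF vector_space_pscale])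
  interpret A: Vector_Spaces.linear pscale pscale "\<lambda>a. a \<star> t_d m q"
    unfolding diff_op_mult_def by (rule linear_bilin_ext_left)
  let ?T = "\<lambda>l. \<rho> (graded_unit n (m - int r - int q) i j l) v"
  let ?b = "\<lambda>s. of_nat (r choose s) * falling (of_int m) s :: complex"
  have single: "\<forall>s. \<exists>c. s \<le> r \<longrightarrow> sigma_basis n \<iota> scale \<rho> (Dop (m - int s) (r + q - s) i j) v
     = (\<Sum>l\<in>S. scale (falling (\<iota> - of_int l) (r + q - s)) (?T l)) + scale c (\<rho> (bvec Kap0) v)"
  proof (intro allI)
    fix s
    show "\<exists>c. s \<le> r \<longrightarrow> sigma_basis n \<iota> scale \<rho> (Dop (m - int s) (r + q - s) i j) v
        = (\<Sum>l\<in>S. scale (falling (\<iota> - of_int l) (r + q - s)) (?T l)) + scale c (\<rho> (bvec Kap0) v)"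
    proof (cases "s \<le> r")
      case True
      then have e: "m - int s - int (r + q - s) = m - int r - int q" by simp
      show ?thesis
        using sigma_basis_Dop_finite[OF vs \<open>finite S\<close>,
            where \<rho> = \<rho> and n = n and i = i and j = j and v = v and m = "m - int s"
              and r = "r + q - s", unfolded e, OF supp, where \<iota> = \<iota>] by metis
    qed simp
  qed
  obtain c where c: "\<forall>s. s \<le> r \<longrightarrow> sigma_basis n \<iota> scale \<rho> (Dop (m - int s) (r + q - s) i j) v
     = (\<Sum>l\<in>S. scale (falling (\<iota> - of_int l) (r + q - s)) (?T l)) + scale (c s) (\<rho> (bvec Kap0) v)"
    using choice[OF single] by blast
  have leibniz: "t_d 0 r \<star> t_d m q = (\<Sum>s\<le>r. pscale (?b s) (t_d (m - int s) (r + q - s)))"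
    by (simp add: diff_op_mult_def)
  have coeff: "(\<Sum>s\<le>r. ?b s * falling \<mu> (r + q - s))
      = falling \<mu> q * falling (of_int m + (\<mu> - of_nat q)) r" for \<mu>
  proof -
    have "falling \<mu> (r + q - s) = falling \<mu> q * falling (\<mu> - of_nat q) (r - s)" if "s \<le> r" for s
      using that falling_add[of \<mu> q "r - s"] by (simp add: add.commute)
    then show ?thesis
      unfolding falling_vandermonde sum_distrib_left by (intro sum.cong) simp_all
  qed
  have "sigma n \<iota> scale \<rho> (mat_elem (pscale d (t_d 0 r) \<star> t_d m q) i j) v
      = scale d (\<Sum>s\<le>r. scale (?b s) (sigma_basis n \<iota> scale \<rho> (Dop (m - int s) (r + q - s) i j) v))"
    unfolding A.scale M.scale L.scale leibniz M.sum L.sum mat_elem_bvec sigma_bvec[OF vs] ..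
  also have "(\<Sum>s\<le>r. scale (?b s) (sigma_basis n \<iota> scale \<rho> (Dop (m - int s) (r + q - s) i j) v))
      = (\<Sum>s\<le>r. (\<Sum>l\<in>S. scale (?b s * falling (\<iota> - of_int l) (r + q - s)) (?T l))
          + scale (?b s * c s) (\<rho> (bvec Kap0) v))"
    by (intro sum.cong refl)
      (simp only: atMost_iff c[rule_format] V.scale_right_distrib V.scale_sum_right V.scale_scale)
  also have "\<dots> = (\<Sum>l\<in>S. scale (\<Sum>s\<le>r. ?b s * falling (\<iota> - of_int l) (r + q - s)) (?T l))
      + scale (\<Sum>s\<le>r. ?b s * c s) (\<rho> (bvec Kap0) v)"
    unfolding sum.distrib V.scale_sum_left by (subst sum.swap) simp
  finally have "sigma n \<iota> scale \<rho> (mat_elem (pscale d (t_d 0 r) \<star> t_d m q) i j) v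
    = (\<Sum>l\<in>S. scale (d * falling (\<iota> - of_int l) q * falling (of_int m + (\<iota> - of_int l - of_nat q)) r)
         (?T l)) + scale (d * (\<Sum>s\<le>r. ?b s * c s)) (\<rho> (bvec Kap0) v)"
    by (simp only: coeff V.scale_right_distrib V.scale_sum_right V.scale_scale)
      (simp only: mult.assoc)
  then show ?thesis by (rule that)
qed

text \<open>
  The exponent of \<open>t\<close> is coupled to \<open>r\<close> so that \<open>r\<close> enters only through falling factorials of
  order \<open>r\<close>: the degrees \<open>p\<close> and \<open>p'\<close> of the two summands and the vectors being summed are free
  of it.
\<close>

lemma sigma_o_hat_gen:
  fixes scale :: "complex \<Rightarrow> 'v \<Rightarrow> 'v::ab_group_add" and p p' :: int
  assumes p'_def: "p' = p + int (ell j) - int (ell i)"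
    and vs: "vector_space scale" and "finite S" "finite S'"
    and supp: "{l. \<rho> (graded_unit n p i j l) v \<noteq> 0} \<subseteq> S"
    and supp': "{l. \<rho> (graded_unit n p' (star n j) (star n i) l) v \<noteq> 0} \<subseteq> S'"
  obtains c where
    "sigma n \<iota> scale \<rho> (o_hat_gen n \<epsilon> ell (p + int r + int (ell j)) r i j) v
    = (\<Sum>l\<in>S. scale (falling (\<iota> - of_int l - of_nat (ell j)) r)
          (scale (falling (\<iota> - of_int l) (ell j)) (\<rho> (graded_unit n p i j l) v)))
    + (\<Sum>l\<in>S'. scale (falling (of_int l - \<iota> - of_int p' - 1) r)
          (scale (- ((-1) ^ \<epsilon>) * falling (\<iota> - of_int l) (ell i))
            (\<rho> (graded_unit n p' (star n j) (star n i) l) v)))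
    + scale c (\<rho> (bvec Kap0) v)"
proof -
  interpret V: vector_space scale by fact
  interpret L: Vector_Spaces.linear pscale scale "\<lambda>x. sigma n \<iota> scale \<rho> x v"
    by (rule linear_sigma[OF vs])
  let ?m = "p + int r + int (ell j)"
  have e: "?m - int (r + ell j) = p" "?m - int r - int (ell i) = p'"
    by (simp_all add: p'_def)
  obtain c1 where c1: "sigma_basis n \<iota> scale \<rho> (Dop ?m (r + ell j) i j) v
      = (\<Sum>l\<in>S. scale (falling (\<iota> - of_int l) (r + ell j)) (\<rho> (graded_unit n p i j l) v))
        + scale c1 (\<rho> (bvec Kap0) v)"
    by (rule sigma_basis_Dop_finite[OF vs \<open>finite S\<close>,
        where \<rho> = \<rho> and n = n and i = i and j = j and v = v
          and m = ?m and r = "r + ell j", unfolded e, OF supp])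
  obtain c2 where c2: "sigma n \<iota> scale \<rho>
        (mat_elem (pscale ((-1) ^ r) (t_d 0 r) \<star> t_d ?m (ell i)) (star n j) (star n i)) v
      = (\<Sum>l\<in>S'. scale ((-1) ^ r * falling (\<iota> - of_int l) (ell i)
            * falling (of_int ?m + (\<iota> - of_int l - of_nat (ell i))) r)
          (\<rho> (graded_unit n p' (star n j) (star n i) l) v)) + scale c2 (\<rho> (bvec Kap0) v)"
    by (rule sigma_diff_op_product[OF vs \<open>finite S'\<close>,
        where \<rho> = \<rho> and n = n and i = "star n j" and j = "star n i" and v = v
          and m = ?m and r = r and q = "ell i", unfolded e, OF supp'])
  have f1: "falling (\<iota> - of_int l) (r + ell j)
      = falling (\<iota> - of_int l - of_nat (ell j)) r * falling (\<iota> - of_int l) (ell j)" for l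
    using falling_add[of "\<iota> - of_int l" "ell j" r] by (simp add: add.commute)
  have f2: "(-1) ^ r * falling (\<iota> - of_int l) (ell i)
            * falling (of_int ?m + (\<iota> - of_int l - of_nat (ell i))) r
      = falling (of_int l - \<iota> - of_int p' - 1) r * falling (\<iota> - of_int l) (ell i)" for l
  proof -
    have "falling (of_int ?m + (\<iota> - of_int l - of_nat (ell i))) r
        = falling (\<iota> - of_int l + of_int p' + of_nat r) r"
      by (simp add: p'_def algebra_simps)
    moreover have "(-1) ^ r * falling (\<iota> - of_int l + of_int p' + of_nat r) r
        = falling (of_int l - \<iota> - of_int p' - 1) r"
      unfolding falling_reflect by (simp add: algebra_simps)
    ultimately show ?thesis by (metis mult.assoc mult.commute)
  qed
  have "sigma n \<iota> scale \<rho> (o_hat_gen n \<epsilon> ell ?m r i j) v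
    = (\<Sum>l\<in>S. scale (falling (\<iota> - of_int l - of_nat (ell j)) r)
          (scale (falling (\<iota> - of_int l) (ell j)) (\<rho> (graded_unit n p i j l) v)))
    + (\<Sum>l\<in>S'. scale (falling (of_int l - \<iota> - of_int p' - 1) r)
          (scale (- ((-1) ^ \<epsilon>) * falling (\<iota> - of_int l) (ell i))
            (\<rho> (graded_unit n p' (star n j) (star n i) l) v)))
    + scale (c1 - (-1) ^ \<epsilon> * c2) (\<rho> (bvec Kap0) v)"
    unfolding o_hat_gen_def L.diff L.scale mat_elem_bvec sigma_bvec[OF vs] c1 c2 f1 f2
    by (simp add: V.scale_right_distrib V.scale_left_diff_distrib V.scale_sum_right
        sum_negf algebra_simps)
  then show ?thesis by (rule that)
qed

section \<open>Comparison of the invariant subspaces\<close>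

lemma half_integer_free_nodes_distinct:
  fixes \<iota> :: complex and l l' p' :: int and q :: nat
  assumes "\<iota> \<notin> {of_int k / 2 |k. True}"
  shows "\<iota> - of_int l - of_nat q \<noteq> of_int l' - \<iota> - of_int p' - 1"
proof
  assume "\<iota> - of_int l - of_nat q = of_int l' - \<iota> - of_int p' - 1"
  then have "2 * \<iota> = of_int (l + int q + l' - p' - 1)"
    by (simp add: algebra_simps)
  moreover have "\<iota> = 2 * \<iota> / 2"
    by simp
  ultimately have "\<iota> = of_int (l + int q + l' - p' - 1) / 2"
    by (rule subst)
  with assms show False by blast
qed

text \<open>
  The generators with a common degree \<open>p\<close> and \<open>r = 0, 1, 2, \<dots>\<close> supply all the falling moments
  of one finite family of vectors, from which interpolation extracts the desired one.
\<close>

lemma o_hat_submodule_graded_unit: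
  fixes scale :: "complex \<Rightarrow> 'v \<Rightarrow> 'v::ab_group_add"
  assumes ij: "i \<in> {1..n}" "j \<in> {1..n}"
    and vs: "vector_space scale"
    and fin: "\<And>k i j v. i \<ge> 1 \<Longrightarrow> j \<ge> 1 \<Longrightarrow> finite {l. \<rho> (graded_unit n k i j l) v \<noteq> 0}"
    and \<iota>: "\<iota> \<notin> {of_int k / 2 |k. True}"
    and W: "submodule scale (o_hat n \<epsilon> ell) (sigma n \<iota> scale \<rho>) W" and "w \<in> W"
  shows "\<rho> (graded_unit n p i j l) w \<in> W"
proof (cases "\<rho> (graded_unit n p i j l) w = 0")
  case True
  interpret V: vector_space scale by fact
  from True W show ?thesis by (simp add: submodule_def V.subspace_0)
next
  case nonzero: False
  interpret V: vector_space scale by fact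
  interpret P: vector_space "pscale :: complex \<Rightarrow> (gl_hat_basis \<Rightarrow>\<^sub>0 complex) \<Rightarrow> _"
    by (rule vector_space_pscale)
  have sub: "V.subspace W" and act: "\<And>x. x \<in> o_hat n \<epsilon> ell \<Longrightarrow> sigma n \<iota> scale \<rho> x w \<in> W"
    using W \<open>w \<in> W\<close> by (auto simp: submodule_def)
  have "bvec Kap \<in> o_hat n \<epsilon> ell"
    unfolding o_hat_def by (rule P.span_base) simp
  from act[OF this] have kap: "\<rho> (bvec Kap0) w \<in> W"
    by (simp add: vs)
  define p' where "p' = p + int (ell j) - int (ell i)"
  define S where "S = {l. \<rho> (graded_unit n p i j l) w \<noteq> 0}"
  define S' where "S' = {l. \<rho> (graded_unit n p' (star n j) (star n i) l) w \<noteq> 0}"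
  have finS: "finite S" "finite S'"
  proof -
    have pos: "i \<ge> 1" "j \<ge> 1" "star n j \<ge> 1" "star n i \<ge> 1"
      using ij by (auto simp: star_def)
    show "finite S" "finite S'"
      unfolding S_def S'_def by (rule fin[OF pos(1,2)], rule fin[OF pos(3,4)])
  qed
  \<comment> \<open>The two summands of a generator become the two halves of one index set.\<close>
  define x :: "int + int \<Rightarrow> complex" where
    "x = case_sum (\<lambda>l. \<iota> - of_int l - of_nat (ell j)) (\<lambda>l. of_int l - \<iota> - of_int p' - 1)"
  define u where "u = case_sum
    (\<lambda>l. scale (falling (\<iota> - of_int l) (ell j)) (\<rho> (graded_unit n p i j l) w))
    (\<lambda>l. scale (- ((-1) ^ \<epsilon>) * falling (\<iota> - of_int l) (ell i))
            (\<rho> (graded_unit n p' (star n j) (star n i) l) w))"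
  have "inj x"
    using half_integer_free_nodes_distinct[OF \<iota>] half_integer_free_nodes_distinct[OF \<iota>, symmetric]
    by (auto simp: x_def inj_on_def split: sum.splits)
  moreover have "(\<Sum>k\<in>S <+> S'. scale (falling (x k) r) (u k)) \<in> W" for r
  proof -
    let ?g = "o_hat_gen n \<epsilon> ell (p + int r + int (ell j)) r i j"
    have "?g \<in> o_hat n \<epsilon> ell"
      unfolding o_hat_def using ij by (intro P.span_base) blast
    then have mem: "sigma n \<iota> scale \<rho> ?g w \<in> W"
      by (rule act)
    obtain c where "sigma n \<iota> scale \<rho> ?g w
        = (\<Sum>k\<in>S <+> S'. scale (falling (x k) r) (u k)) + scale c (\<rho> (bvec Kap0) w)"
      unfolding sum.Plus[OF finS] x_def u_def sum.case o_def
      by (rule sigma_o_hat_gen[where n = n and p = p and i = i and j = j and v = w and r = r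
            and \<rho> = \<rho> and ell = ell, OF p'_def vs finS S_def[THEN equalityD2] S'_def[THEN equalityD2]])
    then have "(\<Sum>k\<in>S <+> S'. scale (falling (x k) r) (u k))
        = sigma n \<iota> scale \<rho> ?g w - scale c (\<rho> (bvec Kap0) w)"
      by simp
    also have "\<dots> \<in> W"
      by (intro V.subspace_diff V.subspace_scale sub mem kap)
    finally show ?thesis .
  qed
  moreover have "Inl l \<in> S <+> S'"
    using nonzero unfolding S_def by (intro InlI CollectI)
  ultimately have "u (Inl l) \<in> W"
    using finS by (intro falling_moments_in_subspace[OF vs sub, of "S <+> S'" x u])
      (auto intro: inj_on_subset)
  then have mem: "scale (falling (\<iota> - of_int l) (ell j)) (\<rho> (graded_unit n p i j l) w) \<in> W"
    by (simp add: u_def)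
  have "\<iota> - of_int l \<notin> \<int>"
  proof
    assume "\<iota> - of_int l \<in> \<int>"
    then obtain k where "\<iota> - of_int l = of_int k" by (rule Ints_cases)
    then have "\<iota> = of_int (2 * (k + l)) / 2" by (simp add: algebra_simps)
    with \<iota> show False by blast
  qed
  then have "falling (\<iota> - of_int l) (ell j) \<noteq> 0"
    by (rule falling_nonzero)
  with V.subspace_scale[OF sub mem, of "1 / falling (\<iota> - of_int l) (ell j)"]
  show ?thesis by simp
qed

lemma gl_inf_submodule_imp_o_hat_submodule:
  assumes "vector_space scale" and W: "submodule scale gl_inf \<rho> W"
  shows "submodule scale (o_hat n \<epsilon> ell) (sigma n \<iota> scale \<rho>) W"
proof -
  interpret V: vector_space scale by fact
  have sub: "V.subspace W" and act: "\<And>x w. x \<in> gl_inf \<Longrightarrow> w \<in> W \<Longrightarrow> \<rho> x w \<in> W"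
    using W by (auto simp: submodule_def)
  have kap: "\<rho> (bvec Kap0) w \<in> W" if "w \<in> W" for w
    using that by (intro act) (simp_all add: gl_inf_def)
  have "sigma_basis n \<iota> scale \<rho> b w \<in> W" if "w \<in> W" for b w
  proof (cases b)
    case (Dop m r i j)
    have "\<rho> (graded_unit n (m - int r) i j l) w \<in> W" for l
      using that graded_unit_index_half_ints[of "m - int r - l" n i]
        graded_unit_index_half_ints(2)[of l n j]
      by (intro act) (auto simp: gl_inf_def)
    then show ?thesis
      unfolding Dop sigma_basis.simps
      by (intro V.subspace_add V.subspace_scale sub subspace_Sum_any[OF assms(1)] kap that)
  qed (simp add: kap that)
  then show ?thesis
    unfolding submodule_def sigma_def
    by (auto intro!: subspace_lin_ext sub assms(1))
qed

theorem theorem3p3: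
  fixes n \<epsilon> :: nat and ell :: "nat \<Rightarrow> nat" and \<iota> :: complex and m :: nat
    and scale :: "complex \<Rightarrow> 'v::ab_group_add \<Rightarrow> 'v"
    and \<rho> :: "(gl_inf_basis \<Rightarrow>\<^sub>0 complex) \<Rightarrow> 'v \<Rightarrow> 'v"
    and M0 :: "'v set"
  assumes "n \<ge> 1"
    and "\<epsilon> \<in> {0, 1}"
    and "\<forall>i\<in>{1..n}. (\<exists>k. ell i = 2 * k + \<epsilon>) \<and> ell i = ell (star n i)"
    and "lie_rep scale gl_inf gl_inf_bracket \<rho>"
    and "weighted scale \<rho>"
    and "module.subspace scale M0"
    and "generated_by scale gl_inf \<rho> M0"
    and "\<forall>x\<in>gl_inf_far m. \<forall>v\<in>M0. \<rho> x v = 0"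
    and "\<iota> \<notin> {of_int k / 2 |k. True}"
  shows "irreducible_rep scale (o_hat n \<epsilon> ell) (sigma n \<iota> scale \<rho>) \<longleftrightarrow>
         irreducible_rep scale gl_inf \<rho>"
proof -
  have vs: "vector_space scale"
    using assms(4) by (simp add: lie_rep_def)
  interpret P: vector_space "pscale :: complex \<Rightarrow> (gl_hat_basis \<Rightarrow>\<^sub>0 complex) \<Rightarrow> _"
    by (rule vector_space_pscale)
  note fin = finite_support[OF assms(1) _ _ assms(4,7,8)]
  have "submodule scale gl_inf \<rho> W"
    if W: "submodule scale (o_hat n \<epsilon> ell) (sigma n \<iota> scale \<rho>) W" for W
  proof -
    have sub: "module.subspace scale W"
      using W by (simp add: submodule_def)
    have "\<rho> x w \<in> W" if x: "x \<in> gl_inf" and w: "w \<in> W" for x w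
      unfolding lie_rep_gl_inf_eq_lin_ext[OF assms(4) x]
    proof (rule subspace_lin_ext[OF vs sub])
      fix b assume b: "b \<in> Poly_Mapping.keys x"
      show "\<rho> (bvec b) w \<in> W"
      proof (cases b)
        case (Einf k l)
        with b x have "k \<in> half_ints" "l \<in> half_ints"
          by (auto simp: gl_inf_def)
        with assms(1) obtain p i j l' where "i \<in> {1..n}" "j \<in> {1..n}"
          "bvec (Einf k l) = graded_unit n p i j l'"
          by (rule graded_unit_exhausts)
        then show ?thesis
          using o_hat_submodule_graded_unit[OF _ _ vs fin assms(9) W w] Einf by simp
      next
        case Kap0
        have "bvec Kap \<in> o_hat n \<epsilon> ell"
          unfolding o_hat_def by (rule P.span_base) simp
        with W w have "sigma n \<iota> scale \<rho> (bvec Kap) w \<in> W"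
          by (auto simp: submodule_def)
        then show ?thesis by (simp add: vs Kap0)
      qed
    qed
    with sub show ?thesis by (simp add: submodule_def)
  qed
  then show ?thesis
    using gl_inf_submodule_imp_o_hat_submodule[OF vs] unfolding irreducible_rep_def by blast
qed

end
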